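(* Consider the system of $N$ agents $\dot x_i = A x_i + B u_i$, $y_i = C x_i$, $i=1,\dots,N$, where $B$ and $C$ have full rank and the system $(A,B,C)$ is output controllable, and let $a_1,\dots,a_N>0$ and $t_0<T<\infty$. Suppose that $\ker(C)$ is $A$-invariant and that the control law $u$ is based on only relative information, i.e. $$u_i = g(y_1-y_i,\dots,y_N-y_i)\quad\text{for all } i \text{ and all } t\ge t_0$$ for some function $g$. Then there is no time-invariant feedback control law $u$ of this kind that is locally Lipschitz continuous in the state, satisfies $g(0,\dots,0)=0$, and solves the following problem: the agents reach consensus in their outputs at time $T$, i.e. $y_i(T)=y_j(T)$ for all $i\neq j$ (for arbitrary initial states), while the cost functional $\int_{t_0}^{T}\sum_{i=1}^{N}a_iu_i^Tu_i\,dt$ is minimized.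
   Context: Here $x_i(t)\in\mathbb{R}^n$, $u_i(t)\in\mathbb{R}^m$, $y_i(t)\in\mathbb{R}^p$, $A\in\mathbb{R}^{n\times n}$, $B\in\mathbb{R}^{n\times m}$, $C\in\mathbb{R}^{p\times n}$; $u=[u_1^T,\dots,u_N^T]^T$; there are at least two agents. Output controllability means that $\int_t^T Ce^{A(T-s)}BB^Te^{A^T(T-s)}C^T\,ds$ is nonsingular for $t<T$. $\ker(C)$ is $A$-invariant if $A\ker(C)\subseteq\ker(C)$. *)

theory Defs
  imports "HOL-Analysis.Analysis"
begin

text \<open>Multiplication and powers on \<^typ>\<open>real^'n^'n\<close> are componentwise, so the library's
  \<^const>\<open>exp\<close> is not available and the exponential series is built from the matrix product.\<close>

primrec matrix_power :: "real^'n^'n \<Rightarrow> nat \<Rightarrow> real^'n^'n" where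
  "matrix_power M 0 = mat 1"
| "matrix_power M (Suc k) = M ** matrix_power M k"

definition matrix_exp :: "real^'n^'n \<Rightarrow> real^'n^'n" where
  "matrix_exp M = (\<Sum>k. (1 / fact k) *\<^sub>R matrix_power M k)"

definition output_controllability_gramian ::
  "real^'n^'n \<Rightarrow> real^'m^'n \<Rightarrow> real^'n^'p \<Rightarrow> real \<Rightarrow> real \<Rightarrow> real^'p^'p" where
  "output_controllability_gramian A B C t T =
     integral {t..T} (\<lambda>s. C ** matrix_exp ((T - s) *\<^sub>R A) ** B ** transpose B
                          ** matrix_exp ((T - s) *\<^sub>R transpose A) ** transpose C)"

text \<open>The Gramian depends only on \<^term>\<open>T - t\<close>, so this property does not depend on
  the terminal time \<^term>\<open>T\<close>.\<close>

definition output_controllable ::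
  "real^'n^'n \<Rightarrow> real^'m^'n \<Rightarrow> real^'n^'p \<Rightarrow> real \<Rightarrow> bool" where
  "output_controllable A B C T \<longleftrightarrow>
     (\<forall>t<T. invertible (output_controllability_gramian A B C t T))"

definition full_rank :: "real^'c^'r \<Rightarrow> bool" where
  "full_rank M \<longleftrightarrow> rank M = min CARD('r) CARD('c)"

definition matrix_kernel :: "real^'n^'p \<Rightarrow> (real^'n) set" where
  "matrix_kernel C = {v. C *v v = 0}"

definition matrix_invariant :: "real^'n^'n \<Rightarrow> (real^'n) set \<Rightarrow> bool" where
  "matrix_invariant A S \<longleftrightarrow> (*v) A ` S \<subseteq> S"

text \<open>The stacked state of all agents has type \<^typ>\<open>(real^'n)^'N\<close> and the stacked control
  \<^typ>\<open>(real^'m)^'N\<close>, where \<^typ>\<open>'N\<close> indexes the agents. Solutions are understood in integrated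
  form, so that square-integrable controls are covered; for a control that is continuous in time
  this is equivalent to the differential equation with initial value \<open>x0\<close> at \<open>t0\<close>.\<close>

definition trajectory ::
  "real^'n^'n \<Rightarrow> real^'m^'n \<Rightarrow> real \<Rightarrow> real \<Rightarrow> (real \<Rightarrow> (real^'m)^'N)
     \<Rightarrow> (real^'n)^'N \<Rightarrow> (real \<Rightarrow> (real^'n)^'N) \<Rightarrow> bool" where
  "trajectory A B t0 T u x0 x \<longleftrightarrow>
     (\<forall>i. \<forall>t\<in>{t0..T}.
        ((\<lambda>s. A *v (x s $ i) + B *v (u s $ i)) has_integral (x t $ i - x0 $ i)) {t0..t})"

definition admissible_control :: "real \<Rightarrow> real \<Rightarrow> (real \<Rightarrow> (real^'m)^'N) \<Rightarrow> bool" where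
  "admissible_control t0 T u \<longleftrightarrow>
     u \<in> borel_measurable (lebesgue_on {t0..T}) \<and>
     integrable (lebesgue_on {t0..T}) (\<lambda>t. (norm (u t))\<^sup>2)"

definition control_cost ::
  "('N::finite \<Rightarrow> real) \<Rightarrow> real \<Rightarrow> real \<Rightarrow> (real \<Rightarrow> (real^'m)^'N) \<Rightarrow> real" where
  "control_cost a t0 T u = integral {t0..T} (\<lambda>t. \<Sum>i\<in>UNIV. a i * (u t $ i \<bullet> u t $ i))"

definition output_consensus :: "real^'n^'p \<Rightarrow> (real^'n)^'N \<Rightarrow> bool" where
  "output_consensus C X \<longleftrightarrow> (\<forall>i j. i \<noteq> j \<longrightarrow> C *v (X $ i) = C *v (X $ j))"

text \<open>A time-invariant feedback law \<open>u\<close> (a function of the stacked state only) solves the problem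
  if, from every initial state, the closed loop has a solution on the whole interval that reaches
  output consensus at time \<open>T\<close>, and the control generated along it has minimal cost among all
  square-integrable controls steering the same initial state to output consensus at time \<open>T\<close>.\<close>

definition solves_optimal_output_consensus ::
  "real^'n^'n \<Rightarrow> real^'m^'n \<Rightarrow> real^'n^'p \<Rightarrow> ('N::finite \<Rightarrow> real) \<Rightarrow> real \<Rightarrow> real
     \<Rightarrow> ((real^'n)^'N \<Rightarrow> (real^'m)^'N) \<Rightarrow> bool" where
  "solves_optimal_output_consensus A B C a t0 T u \<longleftrightarrow>
     (\<forall>x0. \<exists>x. trajectory A B t0 T (\<lambda>t. u (x t)) x0 x \<and>
               admissible_control t0 T (\<lambda>t. u (x t)) \<and>
               output_consensus C (x T) \<and>
               (\<forall>v z. admissible_control t0 T v \<and> trajectory A B t0 T v x0 z \<and>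
                      output_consensus C (z T) \<longrightarrow>
                      control_cost a t0 T (\<lambda>t. u (x t)) \<le> control_cost a t0 T v))"

text \<open>The same \<open>g\<close> is used by every agent; its argument is the tuple of outputs relative to
  that agent, listed in the fixed order of the agents.\<close>

definition relative_information_law ::
  "real^'n^'p \<Rightarrow> ((real^'p)^'N \<Rightarrow> real^'m) \<Rightarrow> ((real^'n)^'N \<Rightarrow> (real^'m)^'N) \<Rightarrow> bool" where
  "relative_information_law C g u \<longleftrightarrow>
     (\<forall>X i. u X $ i = g (\<chi> j. C *v (X $ j) - C *v (X $ i)))"

end

theory Submission
  imports Defs
begin

text \<open>The obstruction is one of reachability: a law of this kind cannot produce output consensus in
  finite time, whatever its cost, unless consensus held from the start. Since the kernel of \<open>C\<close>
  is \<open>A\<close>-invariant, \<open>C A\<close> factors through \<open>C\<close>, so the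
  outputs relative to one fixed agent \<open>k\<close>, that is \<open>e\<^sub>i = C x\<^sub>i - C x\<^sub>k\<close>, obey dynamics of their own:
  \<open>e\<^sub>i' = (C A R) e\<^sub>i + C B (u\<^sub>i - u\<^sub>k)\<close>, where \<open>R\<close> is a right inverse of \<open>C\<close>. The law \<open>u\<close> sees only
  relative outputs, so it is a function of \<open>e\<close>; it is Lipschitz on bounded sets and, because \<open>g\<close>
  vanishes at \<open>0\<close>, it vanishes at \<open>e = 0\<close>. Hence \<open>e\<close> solves a Lipschitz equation with equilibrium
  \<open>0\<close>, and such a solution cannot reach the equilibrium in finite time unless it starts there
  (\<open>backward_uniqueness\<close>, applied in \<open>consensus_only_from_consensus\<close>). Consensus at time \<open>T\<close>
  therefore forces consensus at time \<open>t0\<close>. Output controllability makes \<open>C\<close> surjective, so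
  with two agents there are initial states whose outputs differ.\<close>

text \<open>A vector annihilated by the transpose of \<open>C\<close> is annihilated by the integrand of the Gramian, whose
  rightmost factor is that transpose, hence by the Gramian. If the integrand were not integrable,
  the integral would be \<open>0\<close> by convention and not invertible either.\<close>

lemma right_inverse_if_gramian_invertible:
  fixes A :: "real^'n^'n" and B :: "real^'m^'n" and C :: "real^'n^'p"
  assumes "invertible (output_controllability_gramian A B C t T)"
  obtains R :: "real^'p^'n" where "C ** R = mat 1"
proof -
  let ?G = "output_controllability_gramian A B C t T"
  have inj: "w = 0" if "transpose C *v w = 0" for w
  proof -
    define h :: "real^'p^'p \<Rightarrow> real^'p" where "h = (\<lambda>M. M *v w)"
    have "linear h"
      unfolding h_def by (intro linearI) (auto simp: matrix_vector_mult_add_rdistrib scaleR_matrix_vector_assoc)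
    then have h: "bounded_linear h"
      by (simp add: linear_conv_bounded_linear)
    define F where "F = (\<lambda>s. C ** matrix_exp ((T - s) *\<^sub>R A) ** B ** transpose B
                          ** matrix_exp ((T - s) *\<^sub>R transpose A) ** transpose C)"
    have G: "?G = integral {t..T} F"
      by (simp add: output_controllability_gramian_def F_def)
    have hF: "h (F s) = 0" for s
      using that by (simp add: h_def F_def flip: matrix_vector_mul_assoc)
    have "?G *v w = 0"
    proof (cases "F integrable_on {t..T}")
      case True
      then have "h (integral {t..T} F) = integral {t..T} (h \<circ> F)"
        using integral_linear[OF _ h] by metis
      also have "\<dots> = 0" by (simp add: o_def hF)
      finally show ?thesis by (simp add: h_def G)
    next
      case False
      then show ?thesis by (simp add: G not_integrable_integral)
    qed
    then show "w = 0"
      using assms matrix_left_invertible_ker[of ?G] unfolding invertible_def by blast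
  qed
  then obtain L where "L ** transpose C = mat 1"
    using matrix_left_invertible_ker[of "transpose C"] by blast
  then have "C ** transpose L = mat 1"
    by (metis matrix_transpose_mul transpose_mat transpose_transpose)
  then show thesis by (rule that)
qed

text \<open>Applying \<open>R\<close> after \<open>C\<close> changes a vector only by an element of the kernel of \<open>C\<close>, which stays in
  the kernel under \<open>A\<close>.\<close>

lemma output_dynamics_factor:
  fixes A :: "real^'n^'n" and C :: "real^'n^'p"
  assumes R: "C ** R = mat 1" and inv: "matrix_invariant A (matrix_kernel C)"
  shows "C *v (A *v v) = (C ** A ** R) *v (C *v v)"
proof -
  have "C *v (R *v (C *v v)) = C *v v"
    by (simp add: matrix_vector_mul_assoc matrix_mul_assoc R)
  then have "v - R *v (C *v v) \<in> matrix_kernel C"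
    by (simp add: matrix_kernel_def matrix_vector_mult_diff_distrib)
  then have "A *v (v - R *v (C *v v)) \<in> matrix_kernel C"
    using inv by (auto simp: matrix_invariant_def)
  then show ?thesis
    by (simp add: matrix_kernel_def matrix_vector_mult_diff_distrib flip: matrix_vector_mul_assoc)
qed

text \<open>A linear bound on the speed lets the norm decay at most exponentially, so \<open>exp (2 M t) |e t|\<^sup>2\<close>
  is nondecreasing; it is nonnegative and vanishes at \<open>T\<close>.\<close>

lemma backward_uniqueness:
  fixes e e' :: "real \<Rightarrow> 'a::real_inner"
  assumes deriv: "\<And>t. t \<in> {t0..T} \<Longrightarrow> (e has_vector_derivative e' t) (at t within {t0..T})"
    and bound: "\<And>t. t \<in> {t0..T} \<Longrightarrow> norm (e' t) \<le> M * norm (e t)"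
    and "e T = 0" and "t0 \<le> T"
  shows "e t0 = 0"
proof -
  define w where "w = (\<lambda>t. exp (2 * M * t) * (e t \<bullet> e t))"
  have "continuous_on {t0..T} e"
    using deriv has_vector_derivative_continuous continuous_on_eq_continuous_within by blast
  then have cont: "continuous_on {t0..T} w"
    unfolding w_def by (intro continuous_intros)
  have "w t0 \<le> w T"
  proof (rule DERIV_nonneg_imp_increasing_open[OF \<open>t0 \<le> T\<close> _ cont])
    fix t assume t: "t0 < t" "t < T"
    have "at t within {t0..T} = at t"
      using t by (intro at_within_interior) simp
    with deriv[of t] t have d: "(e has_vector_derivative e' t) (at t)"
      by simp
    have "((\<lambda>t. e t \<bullet> e t) has_vector_derivative (e t \<bullet> e' t + e' t \<bullet> e t)) (at t)"
      by (rule bounded_bilinear.has_vector_derivative[OF bounded_bilinear_inner d d])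
    then have "((\<lambda>t. e t \<bullet> e t) has_real_derivative (2 * (e' t \<bullet> e t))) (at t)"
      by (simp add: has_real_derivative_iff_has_vector_derivative inner_commute)
    then have der: "(w has_real_derivative
        exp (2 * M * t) * (2 * M * (e t \<bullet> e t) + 2 * (e' t \<bullet> e t))) (at t)"
      unfolding w_def by (auto intro!: derivative_eq_intros simp: algebra_simps)
    have "\<bar>e' t \<bullet> e t\<bar> \<le> norm (e' t) * norm (e t)"
      by (rule Cauchy_Schwarz_ineq2)
    also have "\<dots> \<le> M * norm (e t) * norm (e t)"
      using bound[of t] t by (intro mult_right_mono) auto
    finally have "0 \<le> 2 * M * (e t \<bullet> e t) + 2 * (e' t \<bullet> e t)"
      by (simp add: dot_square_norm power2_eq_square abs_le_iff)
    then show "\<exists>y. (w has_real_derivative y) (at t) \<and> 0 \<le> y"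
      using der mult_nonneg_nonneg[OF exp_ge_zero] by blast
  qed
  then have "e t0 \<bullet> e t0 \<le> 0"
    using \<open>e T = 0\<close> by (simp add: w_def mult_le_0_iff not_le)
  then show ?thesis by (metis inner_gt_zero_iff not_less)
qed

lemma has_vector_derivative_vecI:
  fixes x :: "real \<Rightarrow> ('a::euclidean_space)^'k"
  assumes "\<And>i. ((\<lambda>t. x t $ i) has_vector_derivative d $ i) (at t within S)"
  shows "(x has_vector_derivative d) (at t within S)"
proof -
  have "((\<lambda>s. x s $ i \<bullet> b) has_derivative (\<lambda>h. (h *\<^sub>R (d $ i)) \<bullet> b)) (at t within S)" for i and b
    using assms[of i] unfolding has_vector_derivative_def
    by (rule has_derivative_inner_left)
  then show ?thesis
    unfolding has_vector_derivative_def has_derivative_componentwise_within[of x]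
    by (auto simp: Basis_vec_def inner_axis)
qed

text \<open>The integrated form of the system makes a trajectory continuous. Under a continuous feedback the
  integrand is then continuous as well, so the trajectory satisfies the differential equation.\<close>

lemma trajectory_feedback_derivative:
  fixes A :: "real^'n^'n" and B :: "real^'m^'n" and x :: "real \<Rightarrow> (real^'n)^'N"
  assumes traj: "trajectory A B t0 T (\<lambda>t. u (x t)) x0 x"
    and cont: "continuous_on UNIV u" and t: "t \<in> {t0..T}"
  shows "(x has_vector_derivative (\<chi> i. A *v (x t $ i) + B *v (u (x t) $ i))) (at t within {t0..T})"
proof (rule has_vector_derivative_vecI)
  fix i
  define F where "F = (\<lambda>i s. A *v (x s $ i) + B *v (u (x s) $ i))"
  have int: "(F i has_integral (x s $ i - x0 $ i)) {t0..s}" if "s \<in> {t0..T}" for i s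
    using traj that by (simp add: trajectory_def F_def)
  have eq: "x s $ i = x0 $ i + integral {t0..s} (F i)" if "s \<in> {t0..T}" for i s
    using integral_unique[OF int[OF that]] by simp
  have "continuous_on {t0..T} (\<lambda>s. x s $ i)" for i
  proof -
    have "F i integrable_on {t0..T}"
      using int[of T i] t by (auto simp: integrable_on_def)
    then have "continuous_on {t0..T} (\<lambda>s. x0 $ i + integral {t0..s} (F i))"
      by (intro continuous_intros indefinite_integral_continuous_1)
    then show ?thesis
      by (rule continuous_on_eq) (simp add: eq)
  qed
  then have "continuous_on {t0..T} (\<lambda>s. \<chi> i. x s $ i)"
    by (rule continuous_on_vec_lambda)
  then have x: "continuous_on {t0..T} x" by simp
  then have ux: "continuous_on {t0..T} (\<lambda>s. u (x s))"
    using cont continuous_on_compose2 by blast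
  have "continuous_on {t0..T} (F i)"
    unfolding F_def using x ux
    by (intro continuous_intros linear_continuous_on_compose[OF _ matrix_vector_mul_linear])
  then have "((\<lambda>s. x0 $ i + integral {t0..s} (F i)) has_vector_derivative (0 + F i t)) (at t within {t0..T})"
    using t by (intro derivative_intros integral_has_vector_derivative)
  then have "((\<lambda>s. x0 $ i + integral {t0..s} (F i)) has_vector_derivative F i t) (at t within {t0..T})"
    by simp
  then have "((\<lambda>s. x s $ i) has_vector_derivative F i t) (at t within {t0..T})"
    by (rule has_vector_derivative_transform[rotated 2]) (use t eq in auto)
  then show "((\<lambda>s. x s $ i) has_vector_derivative (\<chi> i. A *v (x t $ i) + B *v (u (x t) $ i)) $ i)
               (at t within {t0..T})"
    by (simp add: F_def)
qed

lemma local_lipschitz_zero_linear_bound: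
  fixes u :: "'a::euclidean_space \<Rightarrow> 'b::real_normed_vector"
  assumes "local_lipschitz (UNIV :: real set) UNIV (\<lambda>_. u)" and "u 0 = 0"
  obtains L where "L \<ge> 0" and "\<And>X. norm X \<le> r \<Longrightarrow> norm (u X) \<le> L * norm X"
proof -
  have "local_lipschitz {0::real} (cball 0 r) (\<lambda>_. u)"
    using assms(1) by (rule local_lipschitz_subset) auto
  then obtain L where L: "\<And>t::real. t \<in> {0} \<Longrightarrow> L-lipschitz_on (cball 0 r) u"
    by (rule local_lipschitz_compact_implies_lipschitz) auto
  then have L: "L-lipschitz_on (cball 0 r) u" by blast
  show thesis
  proof
    show "L \<ge> 0" using L by (rule lipschitz_on_nonneg)
    fix X :: 'a assume X: "norm X \<le> r"
    then have "0 \<le> r" using norm_ge_zero order_trans by blast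
    then have "dist (u X) (u 0) \<le> L * dist X 0"
      using X by (intro lipschitz_onD[OF L]) auto
    then show "norm (u X) \<le> L * norm X"
      by (simp add: \<open>u 0 = 0\<close>)
  qed
qed

text \<open>The relative outputs \<open>e\<close> form a closed Lipschitz system with equilibrium \<open>0\<close>: \<open>drift\<close> is the
  factor of \<open>C A\<close> through \<open>C\<close>, and \<open>lift\<close> turns \<open>e\<close> into a state on which \<open>u\<close> takes the
  value that it has on the true state.\<close>

lemma consensus_only_from_consensus:
  fixes A :: "real^'n^'n" and B :: "real^'m^'n" and C :: "real^'n^'p"
    and u :: "(real^'n)^'N \<Rightarrow> (real^'m)^'N"
  assumes R: "C ** R = mat 1" and inv: "matrix_invariant A (matrix_kernel C)"
    and law: "relative_information_law C g u" and "g 0 = 0"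
    and lip: "local_lipschitz (UNIV :: real set) UNIV (\<lambda>_. u)"
    and traj: "trajectory A B t0 T (\<lambda>t. u (x t)) x0 x" and "t0 \<le> T"
    and cons: "output_consensus C (x T)"
  shows "output_consensus C x0"
proof -
  fix k :: 'N
  define E :: "(real^'n)^'N \<Rightarrow> (real^'p)^'N"
    where "E = (\<lambda>X. \<chi> i. C *v (X $ i) - C *v (X $ k))"
  define drift :: "(real^'p)^'N \<Rightarrow> (real^'p)^'N"
    where "drift = (\<lambda>Y. \<chi> i. (C ** A ** R) *v (Y $ i))"
  define input :: "(real^'m)^'N \<Rightarrow> (real^'p)^'N"
    where "input = (\<lambda>U. \<chi> i. C *v (B *v (U $ i)) - C *v (B *v (U $ k)))"
  define lift :: "(real^'p)^'N \<Rightarrow> (real^'n)^'N"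
    where "lift = (\<lambda>Y. \<chi> i. R *v (Y $ i))"
  note lin_simps = vec_eq_iff matrix_vector_right_distrib algebra_simps
    matrix_vector_mult_scaleR
  have "linear E" "linear drift" "linear input" "linear lift"
    by (intro linearI; simp add: lin_simps E_def drift_def input_def lift_def)+
  then have E: "bounded_linear E" and drift: "bounded_linear drift"
    and input: "bounded_linear input" and lift: "bounded_linear lift"
    by (simp_all add: linear_conv_bounded_linear)
  obtain K1 where K1: "\<And>Y. norm (drift Y) \<le> norm Y * K1"
    using bounded_linear.bounded[OF drift] by blast
  obtain K2 where K2: "0 \<le> K2" "\<And>U. norm (input U) \<le> norm U * K2"
    using bounded_linear.nonneg_bounded[OF input] by blast
  obtain K3 where K3: "\<And>Y. norm (lift Y) \<le> norm Y * K3"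
    using bounded_linear.bounded[OF lift] by blast

  have u0: "u 0 = 0"
    using law \<open>g 0 = 0\<close> by (simp add: relative_information_law_def vec_eq_iff zero_vec_def)
  \<comment> \<open>Subtracting the common output of agent \<open>k\<close> leaves all relative outputs unchanged.\<close>
  have u_lift: "u X = u (lift (E X))" for X
  proof -
    have "C *v (lift (E X) $ i) = C *v (X $ i) - C *v (X $ k)" for i
      by (simp add: lift_def E_def matrix_vector_mul_assoc R)
    then have "(\<chi> j. C *v (lift (E X) $ j) - C *v (lift (E X) $ i)) =
        (\<chi> j. C *v (X $ j) - C *v (X $ i))" for i
      by simp
    then have "u X $ i = u (lift (E X)) $ i" for i
      using law unfolding relative_information_law_def by simp
    then show ?thesis
      by (simp add: vec_eq_iff)
  qed

  have ucont: "continuous_on UNIV u"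
    using local_lipschitz_continuous_on[OF lip] by simp
  define e where "e = (\<lambda>t. E (x t))"
  have e_deriv: "(e has_vector_derivative drift (e t) + input (u (x t))) (at t within {t0..T})"
    if "t \<in> {t0..T}" for t
  proof -
    have "(e has_vector_derivative E (\<chi> i. A *v (x t $ i) + B *v (u (x t) $ i)))
            (at t within {t0..T})"
      unfolding e_def
      using trajectory_feedback_derivative[OF traj ucont that]
      by (rule bounded_linear.has_vector_derivative[OF E])
    also have "E (\<chi> i. A *v (x t $ i) + B *v (u (x t) $ i)) = drift (e t) + input (u (x t))"
      by (simp add: vec_eq_iff E_def e_def drift_def input_def matrix_vector_right_distrib
          matrix_vector_mult_diff_distrib output_dynamics_factor[OF R inv])
    finally show ?thesis .
  qed
  then have "continuous_on {t0..T} e"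
    using has_vector_derivative_continuous continuous_on_eq_continuous_within by blast
  then have "continuous_on {t0..T} (\<lambda>t. lift (e t))"
    using bounded_linear.continuous_on[OF lift] by blast
  then have "bounded ((\<lambda>t. lift (e t)) ` {t0..T})"
    by (intro compact_imp_bounded compact_continuous_image) auto
  then obtain r where r: "\<And>t. t \<in> {t0..T} \<Longrightarrow> norm (lift (e t)) \<le> r"
    unfolding bounded_iff by blast
  obtain L where L: "L \<ge> 0" "\<And>X. norm X \<le> r \<Longrightarrow> norm (u X) \<le> L * norm X"
    using local_lipschitz_zero_linear_bound[OF lip u0] by metis
  have "norm (drift (e t) + input (u (x t))) \<le> (K1 + L * K3 * K2) * norm (e t)"
    if "t \<in> {t0..T}" for t
  proof -
    have "norm (u (x t)) \<le> L * norm (lift (e t))"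
      using L(2)[OF r[OF that]] u_lift[of "x t"] by (simp add: e_def)
    also have "\<dots> \<le> L * (norm (e t) * K3)"
      using L(1) K3 by (rule mult_left_mono[rotated])
    finally have "norm (u (x t)) * K2 \<le> L * (norm (e t) * K3) * K2"
      using K2(1) by (rule mult_right_mono)
    then have "norm (input (u (x t))) \<le> L * (norm (e t) * K3) * K2"
      using K2(2) order_trans by blast
    then have "norm (drift (e t) + input (u (x t))) \<le> norm (e t) * K1 + L * (norm (e t) * K3) * K2"
      using K1 by (intro norm_triangle_le add_mono)
    then show ?thesis by (simp add: algebra_simps)
  qed
  moreover have "e T = 0"
  proof -
    have "C *v (x T $ i) = C *v (x T $ k)" for i
      using cons unfolding output_consensus_def by (cases "i = k") auto
    then show ?thesis
      by (simp add: e_def E_def vec_eq_iff)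
  qed
  ultimately have "e t0 = 0"
    using backward_uniqueness[OF e_deriv _ _ \<open>t0 \<le> T\<close>] by blast
  moreover have "x t0 = x0"
  proof -
    have "t0 \<in> {t0..T}" using \<open>t0 \<le> T\<close> by simp
    then have "((\<lambda>s. A *v (x s $ i) + B *v (u (x s) $ i)) has_integral (x t0 $ i - x0 $ i)) {t0..t0}" for i
      using traj unfolding trajectory_def by blast
    from integral_unique[OF this] have "x t0 $ i - x0 $ i = 0" for i
      by simp
    then show ?thesis by (simp add: vec_eq_iff)
  qed
  ultimately have k: "C *v (x0 $ i) = C *v (x0 $ k)" for i
    by (simp add: e_def E_def vec_eq_iff)
  show ?thesis
    unfolding output_consensus_def using trans[OF k sym[OF k]] by blast
qed

theorem lemma3:
  fixes A :: "real^'n^'n" and B :: "real^'m^'n" and C :: "real^'n^'p"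
    and a :: "'N::finite \<Rightarrow> real" and t0 T :: real
  assumes "CARD('N) \<ge> 2"
    and "full_rank B" and "full_rank C"
    and "output_controllable A B C T"
    and "\<forall>i. a i > 0"
    and "t0 < T"
    and "matrix_invariant A (matrix_kernel C)"
  shows "\<not> (\<exists>(u :: (real^'n)^'N \<Rightarrow> (real^'m)^'N) (g :: (real^'p)^'N \<Rightarrow> real^'m).
            relative_information_law C g u \<and>
            local_lipschitz (UNIV :: real set) UNIV (\<lambda>_. u) \<and>
            g 0 = 0 \<and>
            solves_optimal_output_consensus A B C a t0 T u)"
proof
  assume "\<exists>(u :: (real^'n)^'N \<Rightarrow> (real^'m)^'N) (g :: (real^'p)^'N \<Rightarrow> real^'m).
            relative_information_law C g u \<and>
            local_lipschitz (UNIV :: real set) UNIV (\<lambda>_. u) \<and>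
            g 0 = 0 \<and>
            solves_optimal_output_consensus A B C a t0 T u"
  then obtain u :: "(real^'n)^'N \<Rightarrow> (real^'m)^'N" and g :: "(real^'p)^'N \<Rightarrow> real^'m"
    where law: "relative_information_law C g u"
      and lip: "local_lipschitz (UNIV :: real set) UNIV (\<lambda>_. u)" and g0: "g 0 = 0"
      and sol: "solves_optimal_output_consensus A B C a t0 T u"
    by blast
  have "invertible (output_controllability_gramian A B C t0 T)"
    using assms(4) \<open>t0 < T\<close> by (simp add: output_controllable_def)
  then obtain R where R: "C ** R = mat 1"
    by (rule right_inverse_if_gramian_invertible)
  have "\<not> CARD('N) \<le> 1" using assms(1) by simp
  then obtain p q :: 'N where pq: "p \<noteq> q"
    by (metis One_nat_def card_le_Suc0_iff_eq finite UNIV_I)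
  define y :: "real^'p" where "y = 1"
  define x0 :: "(real^'n)^'N" where "x0 = (\<chi> i. if i = p then R *v y else 0)"
  obtain x where "trajectory A B t0 T (\<lambda>t. u (x t)) x0 x" "output_consensus C (x T)"
    using sol unfolding solves_optimal_output_consensus_def by blast
  then have "output_consensus C x0"
    using consensus_only_from_consensus[OF R assms(7) law g0 lip] \<open>t0 < T\<close> by simp
  then have "C *v (x0 $ p) = C *v (x0 $ q)"
    using pq by (auto simp: output_consensus_def)
  then have "y = 0"
    using pq by (simp add: x0_def matrix_vector_mul_assoc R)
  then show False
    by (simp add: y_def vec_eq_iff)
qed

end
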